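(* For every $t\in\mathbb{C}\setminus\{0\}$, every integer $m\ge 0$, and either choice of sign (the same throughout), $$\left.\frac{\partial Y_{\nu}(t)}{\partial\nu}\right|_{\nu=\pm m}=(\pm1)^{m}\left[-\frac{\pi}{2}J_{m}(t)\pm\frac{m!}{2}\sum_{k=0}^{m-1}\frac{Y_{k}(t)}{k!\,(m-k)}\left(\frac{t}{2}\right)^{k-m}\right].$$
   Context: $J_\nu(t)=\sum_{k=0}^{\infty}\frac{(-1)^k}{k!\,\Gamma(k+\nu+1)}\left(\frac{t}{2}\right)^{2k+\nu}$ is the Bessel function of the first kind (principal branch, $-\pi<\arg t\le\pi$; $1/\Gamma$ is zero at the poles of $\Gamma$), and $Y_\nu(t)=\frac{J_\nu(t)\cos\pi\nu-J_{-\nu}(t)}{\sin\pi\nu}$ (for integer $\nu$, the limit in $\nu$) is the Bessel function of the second kind. Empty sums are $0$. *)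

theory Defs
  imports "HOL-Complex_Analysis.Complex_Analysis"
begin

text \<open>
  Bessel functions of complex order \<open>\<nu>\<close> and complex argument \<open>t \<noteq> 0\<close>. The power is the
  principal one: \<open>z powr a = exp (a * Ln z)\<close> with \<open>- pi < Im (Ln z) \<le> pi\<close>. The function
  \<open>rGamma\<close> is the entire reciprocal of \<open>Gamma\<close>, which vanishes at the poles of \<open>Gamma\<close>.
  Since \<open>0 powr a = 0\<close> for every \<open>a\<close>, the values at \<open>t = 0\<close> are not meaningful.
\<close>

definition bessel_J :: "complex \<Rightarrow> complex \<Rightarrow> complex" where
  "bessel_J \<nu> t =
     (\<Sum>k. (-1) ^ k / fact k * rGamma (of_nat k + \<nu> + 1) * (t / 2) powr (2 * of_nat k + \<nu>))"

definition bessel_Y_quot :: "complex \<Rightarrow> complex \<Rightarrow> complex" where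
  "bessel_Y_quot \<nu> t =
     (bessel_J \<nu> t * cos (of_real pi * \<nu>) - bessel_J (- \<nu>) t) / sin (of_real pi * \<nu>)"

definition bessel_Y :: "complex \<Rightarrow> complex \<Rightarrow> complex" where
  "bessel_Y \<nu> t =
     (if \<nu> \<in> \<int> then Lim (at \<nu>) (\<lambda>\<mu>. bessel_Y_quot \<mu> t) else bessel_Y_quot \<nu> t)"

end

(* J_nu(t) is entire in nu, and Y_nu(t) * sin(pi nu) = J_nu(t) cos(pi nu) - J_{-nu}(t) with removable
   singularities. Differentiating this identity once and twice at an integer n gives
     pi Y_n = d/dnu J_nu |_{nu=n} + (-1)^n d/dnu J_nu |_{nu=-n},
     2 pi d/dnu Y_nu |_{nu=n} = G_n - pi^2 J_n,
   where G_n is the second nu-derivative of J_nu at n minus (-1)^n times the one at -n.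
   Differentiating the three-term recurrence of J_nu twice gives, with z = t/2,
     G_{n+1} + G_{n-1} = (n/z) G_n + (2 pi/z) Y_n,
   an inhomogeneous recurrence that pi m! times the finite sum of the theorem satisfies as well. *)

theory Submission
  imports Defs
begin


section \<open>Convergence of the series of J, locally uniform in the order\<close>

text \<open>The value at \<open>w + of_nat N\<close> is the value at \<open>w + of_nat j\<close>
  times a Pochhammer symbol, all of whose factors have norm at least 1.\<close>

lemma norm_rGamma_shift_le:
  fixes w :: complex
  assumes "N \<le> j" and "\<And>i. norm (w + of_nat (N + i)) \<ge> 1"
  shows "norm (rGamma (w + of_nat j)) \<le> norm (rGamma (w + of_nat N))"
proof -
  have "1 \<le> norm (pochhammer (w + of_nat N) (j - N))"
    unfolding pochhammer_prod prod_norm[symmetric]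
    by (rule prod_ge_1) (use assms(2) in \<open>auto simp: add.assoc\<close>)
  moreover have "rGamma (w + of_nat N) = pochhammer (w + of_nat N) (j - N) * rGamma (w + of_nat j)"
    using pochhammer_rGamma[of "w + of_nat N" "j - N"] assms(1) by (simp add: add.assoc of_nat_diff)
  ultimately show ?thesis
    by (simp add: norm_mult mult_le_cancel_right1)
qed

text \<open>Weierstrass M-test: from some index \<open>N\<close> on, the reciprocal Gamma factor is
  dominated by its value at \<open>N\<close>, which together with \<open>(t / 2) powr \<mu>\<close>
  is bounded on the compact disc. What remains is a term of the exponential series at the square of
  \<open>norm (t / 2)\<close>.\<close>

lemma bessel_J_uniform_limit:
  fixes t \<nu> :: complex
  assumes "t \<noteq> 0"
  shows "uniform_limit (cball \<nu> 1)
           (\<lambda>n \<mu>. \<Sum>k<n. (-1) ^ k / fact k * rGamma (of_nat k + \<mu> + 1) * (t / 2) powr (2 * of_nat k + \<mu>))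
           (\<lambda>\<mu>. bessel_J \<mu> t) sequentially"
proof -
  \<comment> \<open>This choice gives \<open>norm \<mu> \<le> N\<close> on the whole disc, so every
    \<open>\<mu> + 1 + of_nat (N + i)\<close> has norm at least 1.\<close>
  obtain N :: nat where N: "norm \<nu> + 1 \<le> of_nat N"
    using real_arch_simple by blast
  let ?g = "\<lambda>\<mu>. rGamma (\<mu> + 1 + of_nat N) * (t / 2) powr \<mu>"
  have "bounded (?g ` cball \<nu> 1)"
    using assms by (intro compact_imp_bounded compact_continuous_image holomorphic_on_imp_continuous_on
        holomorphic_intros) auto
  then obtain B where B: "\<And>\<mu>. \<mu> \<in> cball \<nu> 1 \<Longrightarrow> norm (?g \<mu>) \<le> B"
    unfolding bounded_iff by blast
  define M where "M k = B * ((norm (t / 2))\<^sup>2 ^ k /\<^sub>R fact k)" for k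
  have bound: "norm ((-1) ^ k / fact k * rGamma (of_nat k + \<mu> + 1) * (t / 2) powr (2 * of_nat k + \<mu>)) \<le> M k"
    if "N \<le> k" "\<mu> \<in> cball \<nu> 1" for k \<mu>
  proof -
    have "norm \<mu> \<le> real N"
      using that(2) N norm_triangle_ineq2[of \<mu> \<nu>] by (auto simp: dist_norm norm_minus_commute)
    moreover have "real N + 1 + real i \<le> norm (\<mu> + 1 + of_nat (N + i)) + norm \<mu>" for i
    proof -
      have "norm (of_nat (N + i + 1) :: complex) \<le> norm (\<mu> + 1 + of_nat (N + i)) + norm \<mu>"
        using norm_triangle_ineq4[of "\<mu> + 1 + of_nat (N + i)" \<mu>] by (simp add: algebra_simps)
      then show ?thesis unfolding norm_of_nat by simp
    qed
    ultimately have "1 \<le> norm (\<mu> + 1 + of_nat (N + i))" for i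
      by (smt (verit, best) of_nat_0_le_iff)
    then have "norm (rGamma (\<mu> + 1 + of_nat k)) \<le> norm (rGamma (\<mu> + 1 + of_nat N))"
      by (intro norm_rGamma_shift_le that(1))
    then have "norm (rGamma (\<mu> + 1 + of_nat k)) * norm ((t / 2) powr \<mu>) \<le> B"
      using B[OF that(2)] by (simp add: norm_mult) (meson mult_right_mono norm_ge_zero order_trans)
    then have "norm (rGamma (\<mu> + 1 + of_nat k)) * norm ((t / 2) powr \<mu>) * ((norm (t / 2))\<^sup>2 ^ k /\<^sub>R fact k) \<le> M k"
      unfolding M_def by (intro mult_right_mono) auto
    moreover have "(t / 2) powr (2 * of_nat k + \<mu>) = ((t / 2)\<^sup>2) ^ k * (t / 2) powr \<mu>"
      using assms powr_nat'[of "t/2" "2 * k"] by (simp add: powr_add power_mult)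
    moreover have "of_nat k + \<mu> + 1 = \<mu> + 1 + of_nat k"
      by simp
    ultimately show ?thesis
      by (simp only: norm_mult norm_power norm_inverse norm_minus_cancel norm_one norm_fact power_one
            divide_inverse scaleR_conv_of_real of_real_eq_id id_apply mult_ac mult_1_left mult_1_right)
  qed
  have "summable M"
    unfolding M_def by (intro summable_mult summable_exp_generic)
  then show ?thesis
    unfolding bessel_J_def
    by (intro Weierstrass_m_test_ev[where M = M] eventually_sequentiallyI[of N] ballI bound)
qed

lemma bessel_J_sums:
  assumes "t \<noteq> 0"
  shows "(\<lambda>k. (-1) ^ k / fact k * rGamma (of_nat k + \<nu> + 1) * (t / 2) powr (2 * of_nat k + \<nu>))
           sums bessel_J \<nu> t"
  using tendsto_uniform_limitI[OF bessel_J_uniform_limit[OF assms, of \<nu>], of \<nu>]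
  by (simp add: sums_def)

lemma bessel_J_holomorphic [holomorphic_intros]:
  assumes "t \<noteq> 0"
  shows "(\<lambda>\<nu>. bessel_J \<nu> t) holomorphic_on S"
proof -
  have "(\<lambda>\<nu>. bessel_J \<nu> t) holomorphic_on UNIV"
  proof (rule holomorphic_uniform_sequence)
    fix \<nu>
    show "\<exists>d>0. cball \<nu> d \<subseteq> UNIV \<and> uniform_limit (cball \<nu> d)
           (\<lambda>n \<mu>. \<Sum>k<n. (-1) ^ k / fact k * rGamma (of_nat k + \<mu> + 1) * (t / 2) powr (2 * of_nat k + \<mu>))
           (\<lambda>\<mu>. bessel_J \<mu> t) sequentially"
      using bessel_J_uniform_limit[OF assms, of \<nu>] by (intro exI[of _ 1]) auto
  qed (use assms in \<open>auto intro!: holomorphic_intros\<close>)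
  then show ?thesis by (rule holomorphic_on_subset) simp
qed

section \<open>Recurrence and reflection of J\<close>

text \<open>Termwise comparison with the series of order \<nu>: with z = t/2, its k-th term is
  multiplied by (k + \<nu>)/z on the side of order \<nu> - 1 and by -k/z on the side of order \<nu>
  + 1.\<close>

lemma bessel_J_recurrence:
  assumes "t \<noteq> 0"
  shows "bessel_J (\<nu> - 1) t + bessel_J (\<nu> + 1) t = \<nu> / (t / 2) * bessel_J \<nu> t"
proof -
  define z where "z = t / 2"
  have z: "z \<noteq> 0" using assms by (simp add: z_def)
  define b where "b \<mu> k = (-1) ^ k / fact k * rGamma (of_nat k + \<mu> + 1) * z powr (2 * of_nat k + \<mu>)"
    for \<mu> k
  have b: "b \<mu> sums bessel_J \<mu> t" for \<mu>
    unfolding b_def[abs_def] z_def using bessel_J_sums[OF assms] .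
  \<comment> \<open>The series of order \<nu> + 1 is delayed by one index, so that the k-th terms of
    both series carry the exponent 2k + \<nu> - 1.\<close>
  define c where "c k = (case k of 0 \<Rightarrow> 0 | Suc j \<Rightarrow> b (\<nu> + 1) j)" for k
  have "c sums bessel_J (\<nu> + 1) t"
    using b[of "\<nu> + 1"] sums_Suc_iff[of c] by (simp add: c_def)
  from sums_add[OF b[of "\<nu> - 1"] this]
  have "(\<lambda>k. b (\<nu> - 1) k + c k) sums (bessel_J (\<nu> - 1) t + bessel_J (\<nu> + 1) t)" .
  moreover have "b (\<nu> - 1) k + c k = \<nu> / z * b \<nu> k" for k
  proof -
    \<comment> \<open>The functional equation of \<open>rGamma\<close> holds at the poles of Gamma
      too, so integer orders are no exception.\<close>
    have 1: "b (\<nu> - 1) k = (of_nat k + \<nu>) / z * b \<nu> k"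
      using z by (simp add: b_def powr_diff add_diff_eq mult_ac flip: rGamma_plus1[of "of_nat k + \<nu>"])
    have 2: "c k = - of_nat k / z * b \<nu> k"
    proof (cases k)
      case (Suc j)
      have "z powr (2 * of_nat (Suc j) + \<nu>) = z powr (2 * of_nat j + (\<nu> + 1)) * z"
        using z powr_add[of z "2 * of_nat j + (\<nu> + 1)" 1] by (simp add: algebra_simps)
      then show ?thesis
        using z by (simp add: Suc c_def b_def add_ac del: of_nat_Suc) (simp add: field_simps)
    qed (simp add: c_def)
    show ?thesis using z by (simp add: 1 2 field_simps)
  qed
  ultimately have "(\<lambda>k. \<nu> / z * b \<nu> k) sums (bessel_J (\<nu> - 1) t + bessel_J (\<nu> + 1) t)"
    by simp
  with sums_mult[OF b[of \<nu>], of "\<nu> / z"] show ?thesis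
    unfolding z_def by (rule sums_unique2[symmetric])
qed

text \<open>The first n terms of the series of order -n vanish, because 1/Gamma is zero at the
  nonpositive integers; the remaining terms, shifted by n, are those of order n up to the
  sign.\<close>

lemma bessel_J_minus_of_nat:
  assumes "t \<noteq> 0"
  shows "bessel_J (- of_nat n) t = (-1) ^ n * bessel_J (of_nat n) t"
proof -
  define b where "b \<mu> k = (-1) ^ k / fact k * rGamma (of_nat k + \<mu> + 1) * (t / 2) powr (2 * of_nat k + \<mu>)"
    for \<mu> k
  have b: "b \<mu> sums bessel_J \<mu> t" for \<mu>
    unfolding b_def[abs_def] using bessel_J_sums[OF assms] .
  have "b (- of_nat n) k = 0" if "k < n" for k
  proof -
    have "of_nat k + - of_nat n + 1 = (- of_nat (n - Suc k) :: complex)"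
      using that by (simp add: of_nat_diff)
    then show ?thesis by (simp add: b_def rGamma_eq_zero_iff)
  qed
  then have "(\<lambda>k. b (- of_nat n) (k + n)) sums bessel_J (- of_nat n) t"
    using sums_iff_shift[of "b (- of_nat n)" n] b[of "- of_nat n"] by simp
  moreover have "b (- of_nat n) (k + n) = (-1) ^ n * b (of_nat n) k" for k
  proof -
    have "rGamma (of_nat (k + n) + - of_nat n + 1) = inverse (fact k :: complex)"
         "rGamma (of_nat k + of_nat n + 1) = inverse (fact (k + n) :: complex)"
      using Gamma_fact[of k, where ?'a = complex] Gamma_fact[of "k + n", where ?'a = complex]
      by (simp_all add: rGamma_inverse_Gamma add_ac)
    then show ?thesis
      by (simp add: b_def power_add field_simps)
  qed
  ultimately have "(\<lambda>k. (-1) ^ n * b (of_nat n) k) sums bessel_J (- of_nat n) t"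
    by simp
  with sums_mult[OF b[of "of_nat n"], of "(-1) ^ n"] show ?thesis
    by (rule sums_unique2[symmetric])
qed


section \<open>Derivatives of J in the order\<close>

definition bessel_J_dnu :: "complex \<Rightarrow> complex \<Rightarrow> complex" where
  "bessel_J_dnu \<nu> t = deriv (\<lambda>\<mu>. bessel_J \<mu> t) \<nu>"

definition bessel_J_dnu2 :: "complex \<Rightarrow> complex \<Rightarrow> complex" where
  "bessel_J_dnu2 \<nu> t = deriv (\<lambda>\<mu>. bessel_J_dnu \<mu> t) \<nu>"

text \<open>The chain rule is built in so that shifted and reflected orders such as \<nu> + 1 and
  -\<nu> can be differentiated automatically.\<close>

lemma has_field_derivative_bessel_J [derivative_intros]:
  assumes "t \<noteq> 0" "(g has_field_derivative g') (at x within S)"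
  shows "((\<lambda>x. bessel_J (g x) t) has_field_derivative bessel_J_dnu (g x) t * g') (at x within S)"
  unfolding bessel_J_dnu_def
  by (rule DERIV_chain2[OF holomorphic_derivI[OF bessel_J_holomorphic[OF assms(1), of UNIV]] assms(2)]) auto

lemma has_field_derivative_bessel_J_dnu [derivative_intros]:
  assumes "t \<noteq> 0" "(g has_field_derivative g') (at x within S)"
  shows "((\<lambda>x. bessel_J_dnu (g x) t) has_field_derivative bessel_J_dnu2 (g x) t * g') (at x within S)"
proof -
  have "(\<lambda>\<nu>. bessel_J_dnu \<nu> t) holomorphic_on UNIV"
    unfolding bessel_J_dnu_def by (intro holomorphic_deriv bessel_J_holomorphic assms(1)) auto
  from DERIV_chain2[OF holomorphic_derivI[OF this] assms(2)] show ?thesis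
    unfolding bessel_J_dnu2_def by auto
qed

text \<open>The recurrence of J is an identity in \<nu>, so its two sides have equal derivatives;
  the last term comes from the factor \<nu>.\<close>

lemma bessel_J_dnu_recurrence:
  assumes "t \<noteq> 0"
  shows "bessel_J_dnu (\<nu> - 1) t + bessel_J_dnu (\<nu> + 1) t
           = \<nu> / (t / 2) * bessel_J_dnu \<nu> t + bessel_J \<nu> t / (t / 2)"
proof -
  have "((\<lambda>\<nu>. bessel_J (\<nu> - 1) t + bessel_J (\<nu> + 1) t) has_field_derivative
          bessel_J_dnu (\<nu> - 1) t + bessel_J_dnu (\<nu> + 1) t) (at \<nu>)"
    by (rule derivative_eq_intros refl assms | simp)+
  moreover have "((\<lambda>\<nu>. \<nu> / (t / 2) * bessel_J \<nu> t) has_field_derivative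
          \<nu> / (t / 2) * bessel_J_dnu \<nu> t + bessel_J \<nu> t / (t / 2)) (at \<nu>)"
    by (rule derivative_eq_intros refl assms | use assms in \<open>simp add: field_simps\<close>)+
  ultimately show ?thesis
    unfolding bessel_J_recurrence[OF assms] by (rule DERIV_unique)
qed

text \<open>One more differentiation. The factor 2 arises because the product rule and the
  inhomogeneous term of the previous recurrence each contribute once.\<close>

lemma bessel_J_dnu2_recurrence:
  assumes "t \<noteq> 0"
  shows "bessel_J_dnu2 (\<nu> - 1) t + bessel_J_dnu2 (\<nu> + 1) t
           = \<nu> / (t / 2) * bessel_J_dnu2 \<nu> t + 2 * bessel_J_dnu \<nu> t / (t / 2)"
proof -
  have "((\<lambda>\<nu>. bessel_J_dnu (\<nu> - 1) t + bessel_J_dnu (\<nu> + 1) t) has_field_derivative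
          bessel_J_dnu2 (\<nu> - 1) t + bessel_J_dnu2 (\<nu> + 1) t) (at \<nu>)"
    by (rule derivative_eq_intros refl assms | simp)+
  moreover have "((\<lambda>\<nu>. \<nu> / (t / 2) * bessel_J_dnu \<nu> t + bessel_J \<nu> t / (t / 2)) has_field_derivative
          \<nu> / (t / 2) * bessel_J_dnu2 \<nu> t + 2 * bessel_J_dnu \<nu> t / (t / 2)) (at \<nu>)"
    by (rule derivative_eq_intros refl assms | use assms in \<open>simp add: field_simps\<close>)+
  ultimately show ?thesis
    unfolding bessel_J_dnu_recurrence[OF assms] by (rule DERIV_unique)
qed

section \<open>Y at integer orders: removable singularities and derivatives\<close>

lemma cos_pi_of_nat: "cos (of_real pi * of_nat n) = ((-1) ^ n :: complex)"
  by (metis cos_npi2 cos_of_real of_real_1 of_real_minus of_real_mult of_real_of_nat_eq of_real_power)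

lemma sin_pi_eq_0_iff: "sin (of_real pi * \<nu>) = (0 :: complex) \<longleftrightarrow> \<nu> \<in> \<int>"
  by (auto simp: sin_eq_0 Ints_def)

text \<open>Serves to show that an integer \<open>a\<close> is the only zero of sin(pi \<nu>) in
  \<open>ball a 1\<close>.\<close>

lemma Ints_dist_less_1:
  fixes a b :: complex
  assumes "a \<in> \<int>" "b \<in> \<int>" "dist a b < 1"
  shows "a = b"
proof -
  obtain k l where "a = of_int k" "b = of_int l" using assms by (auto elim!: Ints_cases)
  then have "norm (of_int (k - l) :: complex) < 1" using assms by (simp add: dist_norm)
  then have "k = l" unfolding norm_of_int by linarith
  with \<open>a = of_int k\<close> \<open>b = of_int l\<close> show ?thesis by simp
qed

text \<open>The numerator of \<open>bessel_Y_quot\<close> thus vanishes at every integer, which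
  makes the singularity removable.\<close>

lemma bessel_J_reflect_Ints:
  assumes "t \<noteq> 0" "a \<in> \<int>"
  shows "bessel_J a t * cos (of_real pi * a) = bessel_J (- a) t"
proof -
  obtain n where "a = of_int n" using assms(2) by (elim Ints_cases)
  then consider m where "a = of_nat m" | m where "a = - of_nat m"
    by (cases n rule: int_cases2) auto
  then show ?thesis
    by cases (simp_all add: cos_pi_of_nat bessel_J_minus_of_nat[OF assms(1)] flip: power_mult_distrib)
qed

text \<open>Numerator and denominator of the quotient both vanish at \<open>a\<close>, the
  denominator simply. Dividing both by z - a leaves a holomorphic quotient \<open>p z / q z\<close>,
  whose value at \<open>a\<close> is the limit that defines Y there.\<close>

lemma bessel_Y_near_Ints:
  assumes "t \<noteq> 0" "a \<in> \<int>"
  shows "(\<lambda>\<nu>. bessel_Y \<nu> t) holomorphic_on ball a 1"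
    and "\<And>\<nu>. \<nu> \<in> ball a 1 \<Longrightarrow>
      bessel_Y \<nu> t * sin (of_real pi * \<nu>) = bessel_J \<nu> t * cos (of_real pi * \<nu>) - bessel_J (- \<nu>) t"
proof -
  define N where "N \<nu> = bessel_J \<nu> t * cos (of_real pi * \<nu>) - bessel_J (- \<nu>) t" for \<nu>
  define D where "D \<nu> = sin (of_real pi * \<nu> :: complex)" for \<nu>
  \<comment> \<open>Difference quotients of \<open>N\<close> and \<open>D\<close> at
    \<open>a\<close>, completed by the derivative; both are entire by removability.\<close>
  define p where "p z = (if z = a then deriv N a else (N z - N a) / (z - a))" for z
  define q where "q z = (if z = a then deriv D a else (D z - D a) / (z - a))" for z
  have N0: "N a = 0"
    by (simp add: N_def bessel_J_reflect_Ints[OF assms])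
  have D0: "D z = 0 \<longleftrightarrow> z = a" if "z \<in> ball a 1" for z
    using Ints_dist_less_1[of a z] that assms(2) by (auto simp: D_def sin_pi_eq_0_iff)
  have "(\<lambda>\<nu>. bessel_J (- \<nu>) t) holomorphic_on UNIV"
    unfolding holomorphic_on_def field_differentiable_def
    using has_field_derivative_bessel_J[OF assms(1) DERIV_minus[OF DERIV_ident]] by blast
  then have "N holomorphic_on UNIV"
    unfolding N_def by (intro holomorphic_intros assms)
  then have p: "p holomorphic_on UNIV"
    unfolding p_def by (rule pole_lemma_open) simp
  have "D holomorphic_on UNIV"
    unfolding D_def by (intro holomorphic_intros)
  then have q: "q holomorphic_on UNIV"
    unfolding q_def by (rule pole_lemma_open) simp
  have "(D has_field_derivative of_real pi * cos (of_real pi * a)) (at a)"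
    unfolding D_def by (rule derivative_eq_intros refl | simp)+
  \<comment> \<open>The zero of \<open>D\<close> at \<open>a\<close> is simple, since sine and
    cosine have no common zero.\<close>
  moreover have "cos (of_real pi * a) \<noteq> 0"
    using sin_zero_norm_cos_one[of "of_real pi * a"] sin_pi_eq_0_iff[of a] assms(2) by auto
  ultimately have qa: "q a \<noteq> 0"
    by (simp add: q_def DERIV_imp_deriv)
  have q0: "q z \<noteq> 0" if "z \<in> ball a 1" for z
    using qa D0[OF that] D0[of a] by (cases "z = a") (auto simp: q_def)
  have quot: "bessel_Y_quot z t = p z / q z" if "z \<in> ball a 1" "z \<noteq> a" for z
    using that D0[of a] D0[of z] N0 by (simp add: p_def q_def bessel_Y_quot_def N_def D_def)
  have "isCont (\<lambda>z. p z / q z) a"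
    using holomorphic_on_imp_continuous_on[OF p] holomorphic_on_imp_continuous_on[OF q] qa
    by (auto intro!: continuous_intros simp: continuous_on_eq_continuous_at)
  then have "((\<lambda>z. p z / q z) \<longlongrightarrow> p a / q a) (at a)"
    by (simp add: isCont_def)
  moreover have "eventually (\<lambda>z. p z / q z = bessel_Y_quot z t) (at a)"
    using quot by (auto simp: eventually_at dist_commute intro!: exI[of _ 1])
  ultimately have "((\<lambda>z. bessel_Y_quot z t) \<longlongrightarrow> p a / q a) (at a)"
    by (rule Lim_transform_eventually)
  \<comment> \<open>\<open>Lim\<close> is a definite description, so the limit has to be known to
    exist before \<open>bessel_Y a t\<close> can be evaluated.\<close>
  then have "Lim (at a) (\<lambda>z. bessel_Y_quot z t) = p a / q a"
    by (intro tendsto_Lim) auto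
  then have Y: "bessel_Y z t = p z / q z" if "z \<in> ball a 1" for z
    using quot[of z] Ints_dist_less_1[of a z] that assms(2)
    by (cases "z = a") (auto simp: bessel_Y_def)
  show "(\<lambda>\<nu>. bessel_Y \<nu> t) holomorphic_on ball a 1"
  proof (rule holomorphic_transform)
    show "(\<lambda>z. p z / q z) holomorphic_on ball a 1"
      using p q q0 by (intro holomorphic_intros) (auto intro: holomorphic_on_subset)
  qed (simp add: Y)
  fix \<nu> assume \<nu>: "\<nu> \<in> ball a 1"
  have "bessel_Y \<nu> t * D \<nu> = N \<nu>"
    using Y[OF \<nu>] q0[OF \<nu>] D0[OF \<nu>] D0[of a] N0
    by (cases "\<nu> = a") (auto simp: p_def q_def)
  then show "bessel_Y \<nu> t * sin (of_real pi * \<nu>) = bessel_J \<nu> t * cos (of_real pi * \<nu>) - bessel_J (- \<nu>) t"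
    by (simp add: N_def D_def)
qed

text \<open>Stated for all integers, since the theorem uses it at m and at -m. The sign \<epsilon>
  satisfies \<epsilon>^2 = 1, so multiplying by \<epsilon> solves the differentiated identities for
  Y and its derivative.\<close>

lemma bessel_Y_at_Ints:
  assumes "t \<noteq> 0" "a \<in> \<int>"
  defines "\<epsilon> \<equiv> cos (of_real pi * a)"
  shows "of_real pi * bessel_Y a t = bessel_J_dnu a t + \<epsilon> * bessel_J_dnu (- a) t"
    and "((\<lambda>\<nu>. bessel_Y \<nu> t) has_field_derivative
           (bessel_J_dnu2 a t - \<epsilon> * bessel_J_dnu2 (- a) t) / (2 * of_real pi)
             - of_real pi / 2 * bessel_J a t) (at a)"
proof -
  let ?c = "\<lambda>\<nu>. cos (of_real pi * \<nu> :: complex)" and ?s = "\<lambda>\<nu>. sin (of_real pi * \<nu> :: complex)"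
  note Y = bessel_Y_near_Ints[OF assms(1,2)]
  define Y' where "Y' = deriv (\<lambda>\<nu>. bessel_Y \<nu> t)"
  have Y': "((\<lambda>\<nu>. bessel_Y \<nu> t) has_field_derivative Y' \<nu>) (at \<nu>)" if "\<nu> \<in> ball a 1" for \<nu>
    unfolding Y'_def by (rule holomorphic_derivI[OF Y(1) _ that]) simp
  have "Y' holomorphic_on ball a 1"
    unfolding Y'_def by (intro holomorphic_deriv Y(1)) simp
  then have Y'': "(Y' has_field_derivative deriv Y' \<nu>) (at \<nu>)" if "\<nu> \<in> ball a 1" for \<nu>
    by (rule holomorphic_derivI[OF _ _ that]) simp
  have s: "?s a = 0" and \<epsilon>: "\<epsilon> * \<epsilon> = 1"
    using sin_pi_eq_0_iff[of a] sin_cos_squared_add[of "of_real pi * a"] assms(2)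
    by (auto simp: \<epsilon>_def power2_eq_square)
  \<comment> \<open>The first derivative of the identity is needed on the whole ball, because it is
    differentiated again at \<open>a\<close>.\<close>
  have eq1: "Y' \<nu> * ?s \<nu> + of_real pi * bessel_Y \<nu> t * ?c \<nu>
    = bessel_J_dnu \<nu> t * ?c \<nu> - of_real pi * bessel_J \<nu> t * ?s \<nu> + bessel_J_dnu (- \<nu>) t"
    if "\<nu> \<in> ball a 1" for \<nu>
  proof -
    have "((\<lambda>\<nu>. bessel_Y \<nu> t * ?s \<nu>) has_field_derivative
        Y' \<nu> * ?s \<nu> + of_real pi * bessel_Y \<nu> t * ?c \<nu>) (at \<nu>)"
      by (rule derivative_eq_intros Y'[OF that] refl | simp)+
    then have "((\<lambda>\<nu>. bessel_J \<nu> t * ?c \<nu> - bessel_J (- \<nu>) t) has_field_derivative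
        Y' \<nu> * ?s \<nu> + of_real pi * bessel_Y \<nu> t * ?c \<nu>) (at \<nu>)"
      by (rule has_field_derivative_transform_within_open[where S = "ball a 1"]) (use that Y(2) in auto)
    moreover have "((\<lambda>\<nu>. bessel_J \<nu> t * ?c \<nu> - bessel_J (- \<nu>) t) has_field_derivative
        bessel_J_dnu \<nu> t * ?c \<nu> - of_real pi * bessel_J \<nu> t * ?s \<nu> + bessel_J_dnu (- \<nu>) t) (at \<nu>)"
      by (rule derivative_eq_intros assms refl | simp)+
    ultimately show ?thesis by (rule DERIV_unique)
  qed
  have "\<epsilon> * (of_real pi * bessel_Y a t * \<epsilon>) = \<epsilon> * (bessel_J_dnu a t * \<epsilon> + bessel_J_dnu (- a) t)"
    using eq1[of a] s by (simp add: \<epsilon>_def)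
  moreover have "\<epsilon> * (of_real pi * bessel_Y a t * \<epsilon>) = of_real pi * bessel_Y a t * (\<epsilon> * \<epsilon>)"
    "\<epsilon> * (bessel_J_dnu a t * \<epsilon> + bessel_J_dnu (- a) t) = bessel_J_dnu a t * (\<epsilon> * \<epsilon>) + \<epsilon> * bessel_J_dnu (- a) t"
    by (simp_all add: algebra_simps)
  ultimately show "of_real pi * bessel_Y a t = bessel_J_dnu a t + \<epsilon> * bessel_J_dnu (- a) t"
    by (simp add: \<epsilon>)
  have a: "a \<in> ball a 1" by simp
  \<comment> \<open>The terms with the second derivative of Y and with Y itself carry sin(pi a) = 0;
    the two remaining ones coincide, whence the factor 2.\<close>
  have "((\<lambda>\<nu>. Y' \<nu> * ?s \<nu> + of_real pi * bessel_Y \<nu> t * ?c \<nu>) has_field_derivative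
      2 * of_real pi * Y' a * \<epsilon>) (at a)"
    by (rule derivative_eq_intros Y'[OF a] Y''[OF a] refl | simp add: s \<epsilon>_def)+
  then have "((\<lambda>\<nu>. bessel_J_dnu \<nu> t * ?c \<nu> - of_real pi * bessel_J \<nu> t * ?s \<nu> + bessel_J_dnu (- \<nu>) t)
      has_field_derivative 2 * of_real pi * Y' a * \<epsilon>) (at a)"
    by (rule has_field_derivative_transform_within_open[OF _ open_ball a eq1])
  moreover have "((\<lambda>\<nu>. bessel_J_dnu \<nu> t * ?c \<nu> - of_real pi * bessel_J \<nu> t * ?s \<nu> + bessel_J_dnu (- \<nu>) t)
      has_field_derivative bessel_J_dnu2 a t * \<epsilon> - (of_real pi)\<^sup>2 * bessel_J a t * \<epsilon> - bessel_J_dnu2 (- a) t) (at a)"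
    by (rule derivative_eq_intros assms(1) refl | simp add: s \<epsilon>_def power2_eq_square)+
  ultimately have "2 * of_real pi * Y' a * \<epsilon>
      = bessel_J_dnu2 a t * \<epsilon> - (of_real pi)\<^sup>2 * bessel_J a t * \<epsilon> - bessel_J_dnu2 (- a) t"
    by (rule DERIV_unique)
  then have "2 * of_real pi * Y' a * (\<epsilon> * \<epsilon>)
      = bessel_J_dnu2 a t * (\<epsilon> * \<epsilon>) - (of_real pi)\<^sup>2 * bessel_J a t * (\<epsilon> * \<epsilon>) - \<epsilon> * bessel_J_dnu2 (- a) t"
    by algebra
  then have "2 * of_real pi * Y' a
      = (bessel_J_dnu2 a t - \<epsilon> * bessel_J_dnu2 (- a) t) - of_real pi * (of_real pi * bessel_J a t)"
    by (simp add: \<epsilon> power2_eq_square)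
  then have "2 * of_real pi * Y' a / (2 * of_real pi)
      = (bessel_J_dnu2 a t - \<epsilon> * bessel_J_dnu2 (- a) t) / (2 * of_real pi)
         - of_real pi * (of_real pi * bessel_J a t) / (2 * of_real pi)"
    by (simp only: diff_divide_distrib)
  then have "Y' a = (bessel_J_dnu2 a t - \<epsilon> * bessel_J_dnu2 (- a) t) / (2 * of_real pi)
             - of_real pi / 2 * bessel_J a t"
    by simp
  with Y'[OF a] show "((\<lambda>\<nu>. bessel_Y \<nu> t) has_field_derivative
           (bessel_J_dnu2 a t - \<epsilon> * bessel_J_dnu2 (- a) t) / (2 * of_real pi)
             - of_real pi / 2 * bessel_J a t) (at a)"
    by simp
qed

section \<open>Recurrences at natural orders\<close>

lemma bessel_Y_of_nat:
  assumes "t \<noteq> 0"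
  shows "of_real pi * bessel_Y (of_nat n) t
           = bessel_J_dnu (of_nat n) t + (-1) ^ n * bessel_J_dnu (- of_nat n) t"
  using bessel_Y_at_Ints(1)[OF assms, of "of_nat n"] by (simp add: cos_pi_of_nat)

text \<open>The recurrence of the order derivative is used at n + 1 and at -(n + 1). Its
  inhomogeneous terms cancel by the reflection formula for J, so Y obeys the same homogeneous
  recurrence as J.\<close>

lemma bessel_Y_of_nat_recurrence:
  assumes "t \<noteq> 0"
  shows "bessel_Y (of_nat n) t + bessel_Y (of_nat (Suc (Suc n))) t
           = of_nat (Suc n) / (t / 2) * bessel_Y (of_nat (Suc n)) t"
proof -
  define c :: complex where "c = of_nat (Suc n)"
  define w where "w = inverse (t / 2)"
  have c: "of_nat n = c - 1" "of_nat (Suc (Suc n)) = c + 1" "- c + 1 = - (c - 1)" "- c - 1 = - (c + 1)"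
    by (simp_all add: c_def)
  \<comment> \<open>The reflection sign is \<open>e\<close> at the orders n and n + 2, and
    \<open>- e\<close> at the order n + 1.\<close>
  define e :: complex where "e = (-1) ^ n"
  have e: "e * e = 1"
    by (simp add: e_def flip: power_mult_distrib)
  have rec1: "bessel_J_dnu (c - 1) t + bessel_J_dnu (c + 1) t = w * (c * bessel_J_dnu c t + bessel_J c t)"
    unfolding bessel_J_dnu_recurrence[OF assms] w_def divide_inverse[of _ "t / 2"] by (simp only: algebra_simps)
  have rec2: "bessel_J_dnu (- (c + 1)) t + bessel_J_dnu (- (c - 1)) t
      = w * (- c * bessel_J_dnu (- c) t + bessel_J (- c) t)"
    using bessel_J_dnu_recurrence[OF assms, of "- c", unfolded c divide_inverse[of _ "t / 2"], folded w_def]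
    by (simp add: algebra_simps)
  have J: "bessel_J (- c) t = - (e * bessel_J c t)"
    using bessel_J_minus_of_nat[OF assms, of "Suc n"] by (simp add: c_def e_def)
  have Y: "of_real pi * bessel_Y (c - 1) t = bessel_J_dnu (c - 1) t + e * bessel_J_dnu (- (c - 1)) t"
    "of_real pi * bessel_Y c t = bessel_J_dnu c t - e * bessel_J_dnu (- c) t"
    "of_real pi * bessel_Y (c + 1) t = bessel_J_dnu (c + 1) t + e * bessel_J_dnu (- (c + 1)) t"
    using bessel_Y_of_nat[OF assms, of n, unfolded c] bessel_Y_of_nat[OF assms, of "Suc n", folded c_def]
      bessel_Y_of_nat[OF assms, of "Suc (Suc n)", unfolded c] by (simp_all add: e_def)
  have "of_real pi * (bessel_Y (c - 1) t + bessel_Y (c + 1) t)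
      = (bessel_J_dnu (c - 1) t + bessel_J_dnu (c + 1) t)
        + e * (bessel_J_dnu (- (c + 1)) t + bessel_J_dnu (- (c - 1)) t)"
    unfolding distrib_left[of "of_real pi"] Y distrib_left[of e] by (simp only: ac_simps)
  also have "\<dots> = c * w * (bessel_J_dnu c t - e * bessel_J_dnu (- c) t) + w * bessel_J c t * (1 - e * e)"
    unfolding rec1 rec2 J by (simp only: algebra_simps) simp
  also have "\<dots> = of_real pi * (c * w * bessel_Y c t)"
    unfolding e Y(2)[symmetric] by simp
  finally have "of_real pi * (bessel_Y (c - 1) t + bessel_Y (c + 1) t) = of_real pi * (c * w * bessel_Y c t)" .
  then show ?thesis
    unfolding c(1,2) c_def[symmetric] divide_inverse[of _ "t / 2"] w_def[symmetric] by simp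
qed

text \<open>The same combination of the orders n + 1 and -(n + 1), one derivative higher. Now the
  inhomogeneous terms do not cancel: they add up to the expression of Y of order n + 1 by order
  derivatives of J.\<close>

lemma bessel_J_dnu2_reflect_recurrence:
  assumes "t \<noteq> 0"
  defines "G \<equiv> \<lambda>n. bessel_J_dnu2 (of_nat n) t - (-1) ^ n * bessel_J_dnu2 (- of_nat n) t"
  shows "G n + G (Suc (Suc n))
           = (of_nat (Suc n) * G (Suc n) + 2 * of_real pi * bessel_Y (of_nat (Suc n)) t) / (t / 2)"
proof -
  define c :: complex where "c = of_nat (Suc n)"
  define w where "w = inverse (t / 2)"
  have c: "of_nat n = c - 1" "of_nat (Suc (Suc n)) = c + 1" "- c + 1 = - (c - 1)" "- c - 1 = - (c + 1)"
    by (simp_all add: c_def)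
  define e :: complex where "e = (-1) ^ n"
  have rec1: "bessel_J_dnu2 (c - 1) t + bessel_J_dnu2 (c + 1) t = w * (c * bessel_J_dnu2 c t + 2 * bessel_J_dnu c t)"
    unfolding bessel_J_dnu2_recurrence[OF assms(1)] w_def divide_inverse[of _ "t / 2"] by (simp only: algebra_simps)
  have rec2: "bessel_J_dnu2 (- (c + 1)) t + bessel_J_dnu2 (- (c - 1)) t
      = w * (- c * bessel_J_dnu2 (- c) t + 2 * bessel_J_dnu (- c) t)"
    using bessel_J_dnu2_recurrence[OF assms(1), of "- c", unfolded c divide_inverse[of _ "t / 2"], folded w_def]
    by (simp add: algebra_simps)
  have Y: "of_real pi * bessel_Y c t = bessel_J_dnu c t - e * bessel_J_dnu (- c) t"
    using bessel_Y_of_nat[OF assms(1), of "Suc n", folded c_def] by (simp add: e_def)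
  have "G n + G (Suc (Suc n)) = (bessel_J_dnu2 (c - 1) t + bessel_J_dnu2 (c + 1) t)
      - e * (bessel_J_dnu2 (- (c + 1)) t + bessel_J_dnu2 (- (c - 1)) t)"
    unfolding G_def c e_def by (simp add: distrib_left)
  also have "\<dots> = (c * (bessel_J_dnu2 c t + e * bessel_J_dnu2 (- c) t) + 2 * (of_real pi * bessel_Y c t)) * w"
    unfolding rec1 rec2 Y by (simp add: algebra_simps)
  also have "bessel_J_dnu2 c t + e * bessel_J_dnu2 (- c) t = G (Suc n)"
    unfolding G_def c_def[symmetric] e_def by simp
  finally have "G n + G (Suc (Suc n)) = (c * G (Suc n) + 2 * (of_real pi * bessel_Y c t)) * w" .
  then show ?thesis
    unfolding c_def[symmetric] divide_inverse[of _ "t / 2"] w_def[symmetric] by (simp only: mult.assoc)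
qed

section \<open>The finite sum and its recurrence\<close>

text \<open>Applied with \<open>y k\<close> = Y_k z^k / k! and z = t/2: the hypothesis is then the
  recurrence of Y, and the conclusion is the recurrence of the reflected second derivatives,
  rescaled. The proof inserts \<open>rec\<close> into \<open>A n\<close> and compares the
  coefficients of each \<open>y k\<close>.\<close>

lemma sum_over_difference_recurrence:
  fixes y :: "nat \<Rightarrow> 'a :: field_char_0"
  assumes rec: "\<And>k. z\<^sup>2 * y k = of_nat (Suc k) ^ 2 * y (Suc k) - of_nat (Suc k) * of_nat (Suc (Suc k)) * y (Suc (Suc k))"
  defines "A \<equiv> \<lambda>m. \<Sum>k<m. y k / (of_nat m - of_nat k)"
  shows "of_nat (Suc n) * of_nat (Suc (Suc n)) * A (Suc (Suc n)) + z\<^sup>2 * A n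
           = of_nat (Suc n) ^ 2 * A (Suc n) + 2 * of_nat (Suc n) * y (Suc n)"
proof -
  define m :: 'a where "m = of_nat (Suc n)"
  \<comment> \<open>With m = n + 1, the denominator n - k is written as m - (k + 1) and as m + 1 -
    (k + 2), to match the shifted indices of \<open>y\<close>.\<close>
  have "z\<^sup>2 * A n = (\<Sum>k<n. of_nat (Suc k) ^ 2 * y (Suc k) / (m - of_nat (Suc k)))
       - (\<Sum>k<n. of_nat (Suc k) * of_nat (Suc (Suc k)) * y (Suc (Suc k)) / (m + 1 - of_nat (Suc (Suc k))))"
    by (simp add: A_def sum_distrib_left rec m_def flip: sum_subtractf diff_divide_distrib)
  \<comment> \<open>Reindexing lets the sums start at 0: the factor k^2 vanishes at k = 0, and k (k
    - 1) in the other sum at k = 0 and k = 1.\<close>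
  also have "(\<Sum>k<n. of_nat (Suc k) ^ 2 * y (Suc k) / (m - of_nat (Suc k)))
      = (\<Sum>k<Suc n. of_nat k ^ 2 * y k / (m - of_nat k))"
    by (simp only: sum.lessThan_Suc_shift) simp
  also have "(\<Sum>k<n. of_nat (Suc k) * of_nat (Suc (Suc k)) * y (Suc (Suc k)) / (m + 1 - of_nat (Suc (Suc k))))
      = (\<Sum>k<Suc (Suc n). of_nat k * (of_nat k - 1) * y k / (m + 1 - of_nat k))"
    by (simp only: sum.lessThan_Suc_shift) (simp add: mult_ac)
  also have "\<dots> = (\<Sum>k<Suc n. of_nat k * (of_nat k - 1) * y k / (m + 1 - of_nat k)) + m * (m - 1) * y (Suc n)"
    by (simp add: m_def)
  finally have 1: "z\<^sup>2 * A n = (\<Sum>k<Suc n. of_nat k ^ 2 * y k / (m - of_nat k))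
      - (\<Sum>k<Suc n. of_nat k * (of_nat k - 1) * y k / (m + 1 - of_nat k)) - m * (m - 1) * y (Suc n)"
    by simp
  have "A (Suc (Suc n)) = (\<Sum>k<Suc n. y k / (m + 1 - of_nat k)) + y (Suc n)"
    unfolding A_def by (subst sum.lessThan_Suc) (simp add: m_def add_ac del: sum.lessThan_Suc)
  then have 2: "m * (m + 1) * A (Suc (Suc n))
      = (\<Sum>k<Suc n. m * (m + 1) * y k / (m + 1 - of_nat k)) + m * (m + 1) * y (Suc n)"
    by (simp only: distrib_left[of "m * (m + 1)"] sum_distrib_left times_divide_eq_right)
  have 3: "m\<^sup>2 * A (Suc n) = (\<Sum>k<Suc n. m\<^sup>2 * y k / (m - of_nat k))"
    by (simp add: A_def m_def sum_distrib_left distrib_left)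
  \<comment> \<open>Rests on m (m + 1) - k (k - 1) = (m + k) (m + 1 - k) and (m + k) + k^2 / (m - k)
    = m^2 / (m - k).\<close>
  have "m * (m + 1) * y k / (m + 1 - of_nat k) + of_nat k ^ 2 * y k / (m - of_nat k)
      - of_nat k * (of_nat k - 1) * y k / (m + 1 - of_nat k) = m\<^sup>2 * y k / (m - of_nat k)" if "k < Suc n" for k
  proof -
    have "m - of_nat k = of_nat (Suc n - k)" "m + 1 - of_nat k = of_nat (Suc (Suc n) - k)"
      using that by (simp_all add: m_def of_nat_diff)
    then have "m - of_nat k \<noteq> 0" "m + 1 - of_nat k \<noteq> 0"
      using that by (simp_all del: of_nat_diff)
    then show ?thesis by (simp add: divide_simps) (simp add: algebra_simps power2_eq_square)
  qed
  then have "(\<Sum>k<Suc n. m * (m + 1) * y k / (m + 1 - of_nat k)) + (\<Sum>k<Suc n. of_nat k ^ 2 * y k / (m - of_nat k))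
      - (\<Sum>k<Suc n. of_nat k * (of_nat k - 1) * y k / (m + 1 - of_nat k)) = (\<Sum>k<Suc n. m\<^sup>2 * y k / (m - of_nat k))"
    by (simp only: sum.distrib[symmetric] sum_subtractf[symmetric]) (rule sum.cong, auto)
  \<comment> \<open>The boundary terms m (m + 1) y_m and -m (m - 1) y_m combine into the source term
    2 m y_m.\<close>
  with 1 2 3 have "m * (m + 1) * A (Suc (Suc n)) + z\<^sup>2 * A n = m\<^sup>2 * A (Suc n) + 2 * m * y (Suc n)"
    by algebra
  then show ?thesis by (simp add: m_def add_ac)
qed

text \<open>Two-step induction on m: after multiplication by z^m both sides satisfy the same
  second-order recurrence, and they agree at m = 0 and m = 1.\<close>

lemma bessel_J_dnu2_reflect_eq:
  assumes "t \<noteq> 0"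
  shows "bessel_J_dnu2 (of_nat m) t - (-1) ^ m * bessel_J_dnu2 (- of_nat m) t
    = of_real pi * fact m * (\<Sum>k<m. bessel_Y (of_nat k) t / (fact k * (of_nat m - of_nat k))
                                   * (t / 2) powi (int k - int m))"
proof -
  define z where "z = t / 2"
  have z: "z \<noteq> 0" using assms by (simp add: z_def)
  define G where "G n = bessel_J_dnu2 (of_nat n) t - (-1) ^ n * bessel_J_dnu2 (- of_nat n) t" for n
  \<comment> \<open>With this scaling the sum of the theorem becomes
    \<open>A m / z ^ m\<close>.\<close>
  define y where "y k = bessel_Y (of_nat k) t * z ^ k / fact k" for k
  define A where "A m = (\<Sum>k<m. y k / (of_nat m - of_nat k))" for m
  have rec_G: "G n + G (Suc (Suc n)) = (of_nat (Suc n) * G (Suc n) + 2 * of_real pi * bessel_Y (of_nat (Suc n)) t) / z" for n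
    using bessel_J_dnu2_reflect_recurrence[OF assms] by (simp only: G_def z_def)
  have rec_y: "z\<^sup>2 * y k = of_nat (Suc k) ^ 2 * y (Suc k) - of_nat (Suc k) * of_nat (Suc (Suc k)) * y (Suc (Suc k))" for k
  proof -
    define c d :: complex where "c = of_nat (Suc k)" and "d = of_nat (Suc (Suc k))"
    have nz: "c \<noteq> 0" "d \<noteq> 0"
      unfolding c_def d_def by (rule of_nat_neq_0)+
    have f: "fact (Suc k) = c * fact k" "fact (Suc (Suc k)) = d * (c * fact k)"
      unfolding fact_Suc c_def[symmetric] d_def[symmetric] by simp_all
    have Y: "bessel_Y d t = c / z * bessel_Y c t - bessel_Y (of_nat k) t"
      using bessel_Y_of_nat_recurrence[OF assms, of k] unfolding c_def d_def z_def
      by (simp add: algebra_simps)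
    show ?thesis
      unfolding y_def f unfolding c_def[symmetric] d_def[symmetric] Y
      using nz z by (simp add: field_simps power2_eq_square)
  qed
  have "z ^ m * G m = of_real pi * fact m * A m" for m
  proof (induction m rule: induct_nat_012)
    case 0
    show ?case by (simp add: G_def A_def)
  next
    case 1
    \<comment> \<open>At order 0 the recurrence joins the orders -1 and 1, and its term with the
      factor \<nu> drops out.\<close>
    have "z * G 1 = 2 * bessel_J_dnu 0 t"
      using bessel_J_dnu2_recurrence[OF assms, of 0] z by (simp add: G_def z_def field_simps)
    also have "\<dots> = of_real pi * bessel_Y 0 t"
      using bessel_Y_of_nat[OF assms, of 0] by simp
    finally show ?case by (simp add: A_def y_def)
  next
    case (ge2 n)
    define c :: complex where "c = of_nat (Suc n)"
    have c: "of_nat (Suc (Suc n)) = c + 1" by (simp add: c_def)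
    have f: "fact (Suc n) = c * fact n" "fact (Suc (Suc n)) = (c + 1) * c * fact n"
      unfolding fact_Suc c_def[symmetric] c by simp_all
    have "c \<noteq> 0" unfolding c_def by (rule of_nat_neq_0)
    then have Y: "bessel_Y c t * z ^ Suc n = c * fact n * y (Suc n)"
      unfolding y_def f c_def[symmetric] by simp
    have "z * G (Suc (Suc n)) = c * G (Suc n) + 2 * of_real pi * bessel_Y c t - z * G n"
      using rec_G[of n, folded c_def] z by (simp add: field_simps)
    moreover have "z ^ Suc (Suc n) * G (Suc (Suc n)) = z ^ Suc n * (z * G (Suc (Suc n)))"
      by simp
    ultimately have "z ^ Suc (Suc n) * G (Suc (Suc n)) = c * (z ^ Suc n * G (Suc n))
        + 2 * of_real pi * (bessel_Y c t * z ^ Suc n) - z\<^sup>2 * (z ^ n * G n)"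
      by (simp only:) (simp add: algebra_simps power2_eq_square)
    also have "\<dots> = of_real pi * fact n * (c\<^sup>2 * A (Suc n) + 2 * c * y (Suc n) - z\<^sup>2 * A n)"
      unfolding ge2 Y f by algebra
    also have "c\<^sup>2 * A (Suc n) + 2 * c * y (Suc n) - z\<^sup>2 * A n = c * (c + 1) * A (Suc (Suc n))"
      using sum_over_difference_recurrence[of z y n, OF rec_y] unfolding A_def[symmetric] unfolding c_def[symmetric] c
      by (simp add: algebra_simps)
    finally show ?case unfolding f by (simp only: mult_ac)
  qed
  then have "G m = of_real pi * fact m * (A m / z ^ m)"
    using z by (simp add: field_simps)
  also have "A m / z ^ m = (\<Sum>k<m. bessel_Y (of_nat k) t / (fact k * (of_nat m - of_nat k)) * z powi (int k - int m))"
    using z by (simp add: A_def y_def sum_divide_distrib power_int_diff mult_ac)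
  finally show ?thesis by (simp only: G_def z_def)
qed

section \<open>The derivative of Y at m and at -m\<close>

theorem corollary3p6:
  fixes t \<sigma> :: complex and m :: nat
  assumes "t \<noteq> 0"
    and "\<sigma> = 1 \<or> \<sigma> = -1"
  shows "((\<lambda>\<nu>. bessel_Y \<nu> t) has_field_derivative
           \<sigma> ^ m * (- (of_real pi / 2) * bessel_J (of_nat m) t
             + \<sigma> * (fact m / 2) *
               (\<Sum>k<m. bessel_Y (of_nat k) t / (fact k * (of_nat m - of_nat k))
                      * (t / 2) powi (int k - int m))))
         (at (\<sigma> * of_nat m))"
proof -
  define S where "S = (\<Sum>k<m. bessel_Y (of_nat k) t / (fact k * (of_nat m - of_nat k))
                      * (t / 2) powi (int k - int m))"
  have S: "bessel_J_dnu2 (of_nat m) t = of_real pi * fact m * S + (-1) ^ m * bessel_J_dnu2 (- of_nat m) t"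
    using bessel_J_dnu2_reflect_eq[OF assms(1), of m] by (simp add: S_def algebra_simps)
  show ?thesis
    unfolding S_def[symmetric] using assms(2)
  proof
    assume "\<sigma> = 1"
    then show "((\<lambda>\<nu>. bessel_Y \<nu> t) has_field_derivative
        \<sigma> ^ m * (- (of_real pi / 2) * bessel_J (of_nat m) t + \<sigma> * (fact m / 2) * S)) (at (\<sigma> * of_nat m))"
      using bessel_Y_at_Ints(2)[OF assms(1), of "of_nat m"] by (simp add: cos_pi_of_nat S)
  next
    assume \<sigma>: "\<sigma> = -1"
    \<comment> \<open>Exchanging m and -m multiplies the reflected combination by -(-1)^m; this is
      the origin of the inner sign in front of the sum.\<close>
    have "bessel_J_dnu2 (- of_nat m) t - (-1) ^ m * bessel_J_dnu2 (of_nat m) t = - ((-1) ^ m * of_real pi * fact m * S)"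
      unfolding S by (simp add: distrib_left flip: power_mult_distrib mult.assoc)
    then have "((\<lambda>\<nu>. bessel_Y \<nu> t) has_field_derivative
        - ((-1) ^ m * of_real pi * fact m * S) / (2 * of_real pi)
          - of_real pi / 2 * ((-1) ^ m * bessel_J (of_nat m) t)) (at (- of_nat m))"
      using bessel_Y_at_Ints(2)[OF assms(1), of "- of_nat m"]
      by (simp add: cos_pi_of_nat bessel_J_minus_of_nat[OF assms(1)])
    then show "((\<lambda>\<nu>. bessel_Y \<nu> t) has_field_derivative
        \<sigma> ^ m * (- (of_real pi / 2) * bessel_J (of_nat m) t + \<sigma> * (fact m / 2) * S)) (at (\<sigma> * of_nat m))"
      by (simp add: \<sigma> algebra_simps)
  qed
qed

end
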